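(* Let $n\ge1$ and $0\le k\le n-1$. The map $\Psi:\mathcal{C}(B_n,k)\to\mathcal{S}(n,n-k)$ from rook placements of $k$ rooks on the staircase board $B_n$ to set partitions of $[n]$ with $n-k$ blocks (constructed in the context) is a weight-preserving bijection, that is, $\Psi$ is a bijection and $F_C(q)=F_{\Psi(C)}(q)$ for all $C\in\mathcal{C}(B_n,k)$.
   Context: Here $q$ is an indeterminate and $[n]=\{1,\ldots,n\}$. Rook placements. $B_n$ is the staircase board $\{(i,j):1\le i<j\le n\}$ inside the $n\times n$ grid, squares indexed as matrix entries (row $i$ from the top, column $j$ from the left). $\mathcal{C}(B_n,k)$ is the set of placements of $k$ rooks on squares of $B_n$ with at most one rook in each row and each column. A square of $B_n$ is a north-east square of $C$ if it is not occupied by a rook and lies directly north of a rook (same column, above) or directly east of a rook (same row, to the right). $\mathrm{ne}(C_i)$ is the number of north-east squares of $C$ in column $i$. The weight of the $i$th column is $C_i(q)=(q-1)^{\#\text{rooks in column } i}\,q^{\mathrm{ne}(C_i)}$, and the weight of $C$ is $F_C(q)=\prod_{i=1}^n C_i(q)$. Set partitions. $\mathcal{S}(n,m)$ is the set of set partitions of $[n]$ into $m$ nonempty blocks. Blocks of a set partition $S=(s_1,\ldots,s_m)$ are always listed so that $|s_1|\ge|s_2|\ge\cdots\ge|s_m|$, and $\min s_i<\min s_{i+1}$ if $|s_i|=|s_{i+1}|$; $S$ is drawn as a diagram whose $i$th row is $s_i$ in increasing order. $\ell(S)$ is the number of blocks. For $1\le i\le n$, $S^{(i)}$ is the set partition of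 $[i]$ obtained by restricting $S$ to $[i]$ (discarding empty blocks), with blocks reordered by the same convention; $\ell(S^{(0)})=0$. If $i$ is the least element of its block (i.e. is in the first column), set $S^{(i)}(q)=q^{\,i-1-\ell(S^{(i-1)})}$. Otherwise let $u$ be the least element of the block of $S^{(i)}$ containing $i$, let $r$ be the index of the block (row) of $S^{(i-1)}$ containing $u$, and set $S^{(i)}(q)=(q-1)q^{\,i-1-r}$. The weight of $S$ is $F_S(q)=\prod_{i=1}^nS^{(i)}(q)$. The map $\Psi$. Given $C\in\mathcal{C}(B_n,k)$, set $S^{(1)}=\{\{1\}\}$. For $i=2,\ldots,n$, given $S^{(i-1)}=(S^{(i-1)}_1,\ldots,S^{(i-1)}_m)$ with blocks ordered by the convention above, one has $i-1-m\le\deg C_i(q)\le i-1$; put $j=i-\deg C_i(q)\in\{1,\ldots,m+1\}$ and obtain $S^{(i)}$ by inserting $i$ into the $j$th block of $S^{(i-1)}$ (if $j=m+1$, by adding the new block $\{i\}$), then reordering the blocks by the convention. Finally $\Psi(C)=S^{(n)}$. *)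

theory Defs
  imports "HOL-Computational_Algebra.Polynomial" "HOL-Library.Disjoint_Sets"
begin

text \<open>Weights are elements of \<open>\<int>[q]\<close>, with \<open>q\<close> the polynomial variable.\<close>

definition q :: "int poly" where
  "q = [:0, 1:]"

text \<open>The square \<open>(r, c)\<close> lies in row \<open>r\<close>, counted from the top, and in column \<open>c\<close>,
  counted from the left.\<close>

definition staircase :: "nat \<Rightarrow> (nat \<times> nat) set" where
  "staircase n = {(r, c). 1 \<le> r \<and> r < c \<and> c \<le> n}"

definition rook_placements :: "nat \<Rightarrow> nat \<Rightarrow> (nat \<times> nat) set set" where
  "rook_placements n k = {C. C \<subseteq> staircase n \<and> card C = k \<and>
     (\<forall>x\<in>C. \<forall>y\<in>C. x \<noteq> y \<longrightarrow> fst x \<noteq> fst y \<and> snd x \<noteq> snd y)}"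

text \<open>A square may lie at any distance from the rook to its south or west.\<close>

definition ne_squares :: "nat \<Rightarrow> (nat \<times> nat) set \<Rightarrow> (nat \<times> nat) set" where
  "ne_squares n C = {(r, c). (r, c) \<in> staircase n \<and> (r, c) \<notin> C \<and>
     ((\<exists>r'>r. (r', c) \<in> C) \<or> (\<exists>c'<c. (r, c') \<in> C))}"

definition ne :: "nat \<Rightarrow> (nat \<times> nat) set \<Rightarrow> nat \<Rightarrow> nat" where
  "ne n C i = card {r. (r, i) \<in> ne_squares n C}"

definition column_weight :: "nat \<Rightarrow> (nat \<times> nat) set \<Rightarrow> nat \<Rightarrow> int poly" where
  "column_weight n C i = (q - 1) ^ card {r. (r, i) \<in> C} * q ^ ne n C i"

definition rook_weight :: "nat \<Rightarrow> (nat \<times> nat) set \<Rightarrow> int poly" where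
  "rook_weight n C = (\<Prod>i=1..n. column_weight n C i)"

definition set_partitions :: "nat \<Rightarrow> nat \<Rightarrow> nat set set set" where
  "set_partitions n m = {S. partition_on {1..n} S \<and> card S = m}"

definition precedes :: "nat set \<Rightarrow> nat set \<Rightarrow> bool" where
  "precedes s t \<longleftrightarrow> card s > card t \<or> card s = card t \<and> Min s < Min t"

text \<open>A set partition is an unordered set of blocks; \<open>blocks S\<close> lists them in the
  conventional order. Lists are indexed from 0, so the \<open>j\<close>th block is
  \<open>blocks S ! (j - 1)\<close>.\<close>

definition blocks :: "nat set set \<Rightarrow> nat set list" where
  "blocks S = (THE xs. set xs = S \<and> sorted_wrt precedes xs)"

definition restrict_partition :: "nat set set \<Rightarrow> nat \<Rightarrow> nat set set" where
  "restrict_partition S i = (\<lambda>s. s \<inter> {1..i}) ` S - {{}}"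

definition block_of :: "nat set set \<Rightarrow> nat \<Rightarrow> nat set" where
  "block_of S x = (THE s. s \<in> S \<and> x \<in> s)"

definition row_of :: "nat set set \<Rightarrow> nat \<Rightarrow> nat" where
  "row_of S x = (THE r. 1 \<le> r \<and> r \<le> card S \<and> x \<in> blocks S ! (r - 1))"

definition step_weight :: "nat set set \<Rightarrow> nat \<Rightarrow> int poly" where
  "step_weight S i =
    (let S' = restrict_partition S (i - 1);
         u = Min (block_of (restrict_partition S i) i)
     in if i = u then q ^ (i - 1 - card S')
        else (q - 1) * q ^ (i - 1 - row_of S' u))"

definition partition_weight :: "nat \<Rightarrow> nat set set \<Rightarrow> int poly" where
  "partition_weight n S = (\<Prod>i=1..n. step_weight S i)"

definition insert_at :: "nat \<Rightarrow> nat \<Rightarrow> nat set set \<Rightarrow> nat set set" where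
  "insert_at i j S =
    (if j = card S + 1 then insert {i} S
     else let s = blocks S ! (j - 1) in insert (insert i s) (S - {s}))"

text \<open>For a placement on the staircase the degree of the \<open>i\<close>th column weight lies between
  \<open>i - 1 - m\<close> and \<open>i - 1\<close>, where \<open>m\<close> is the current number of blocks; hence \<open>j\<close> lies between
  \<open>1\<close> and \<open>m + 1\<close> and the subtraction does not truncate. The value at \<open>0\<close> is never used
  when \<open>n \<ge> 1\<close>.\<close>

fun Psi_step :: "nat \<Rightarrow> (nat \<times> nat) set \<Rightarrow> nat \<Rightarrow> nat set set" where
  "Psi_step n C 0 = {}"
| "Psi_step n C (Suc 0) = {{1}}"
| "Psi_step n C (Suc (Suc i)) =
     insert_at (Suc (Suc i)) (Suc (Suc i) - degree (column_weight n C (Suc (Suc i))))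
       (Psi_step n C (Suc i))"

definition Psi :: "nat \<Rightarrow> (nat \<times> nat) set \<Rightarrow> nat set set" where
  "Psi n C = Psi_step n C n"

lemma ex1_sorted_wrt:
  assumes "finite S" and "transp r" and "irreflp r" and "totalp_on S r"
  shows "\<exists>!xs. set xs = S \<and> sorted_wrt r xs"
  using assms(1,4)
proof (induction S rule: finite_psubset_induct)
  case (psubset S)
  show ?case
  proof (cases "S = {}")
    case True
    then show ?thesis by auto
  next
    case False
    have "asymp_on S r"
      by (rule asymp_onI) (use assms(2,3) in \<open>blast dest: transpD irreflpD\<close>)
    moreover have "transp_on S r"
      by (rule transp_on_subset[OF assms(2)]) simp
    ultimately obtain m where m: "m \<in> S" "\<forall>x\<in>S. x \<noteq> m \<longrightarrow> \<not> r x m"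
      using Finite_Set.bex_min_element[OF psubset.hyps _ _ False, of r] by blast
    then have below: "\<forall>x\<in>S. x \<noteq> m \<longrightarrow> r m x"
      using psubset.prems by (metis totalp_onD)
    have "totalp_on (S - {m}) r"
      using psubset.prems by (auto simp: totalp_on_def)
    then have "\<exists>!xs. set xs = S - {m} \<and> sorted_wrt r xs"
      using psubset.IH[of "S - {m}"] m(1) by blast
    then obtain xs where xs: "set xs = S - {m}" "sorted_wrt r xs"
      and uniq: "\<And>ys. set ys = S - {m} \<Longrightarrow> sorted_wrt r ys \<Longrightarrow> ys = xs"
      by (metis (mono_tags, lifting))
    show ?thesis
    proof
      show "set (m # xs) = S \<and> sorted_wrt r (m # xs)"
        using xs m(1) below by auto
    next
      fix ys assume ys: "set ys = S \<and> sorted_wrt r ys"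
      then obtain y zs where yz: "ys = y # zs"
        using False by (cases ys) auto
      have "y = m"
        using ys yz m by auto
      moreover have "y \<notin> set zs"
        using ys yz assms(3) by (auto dest: irreflpD)
      ultimately have "set zs = S - {m}" "sorted_wrt r zs"
        using ys yz by auto
      then show "ys = m # xs"
        using uniq yz \<open>y = m\<close> by blast
    qed
  qed
qed

lemma blocks_unique:
  assumes "partition_on {1..n} S"
  shows "\<exists>!xs. set xs = S \<and> sorted_wrt precedes xs"
proof (rule ex1_sorted_wrt)
  show "finite S"
    using finite_elements[OF _ assms] by simp
  show "transp precedes"
    by (rule transpI) (auto simp: precedes_def)
  show "irreflp precedes"
    by (rule irreflpI) (auto simp: precedes_def)
  show "totalp_on S precedes"
  proof (rule totalp_onI)
    fix s t assume st: "s \<in> S" "t \<in> S" "s \<noteq> t"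
    have "s \<subseteq> {1..n}" "t \<subseteq> {1..n}" "s \<noteq> {}" "t \<noteq> {}"
      using assms st unfolding partition_on_def by blast+
    moreover from this have "finite s" "finite t"
      using finite_subset by blast+
    ultimately have "Min s \<in> s" "Min t \<in> t"
      by auto
    moreover have "s \<inter> t = {}"
      using disjointD[OF partition_onD2[OF assms]] st by blast
    ultimately have "Min s \<noteq> Min t"
      by auto
    then show "precedes s t \<or> precedes t s"
      by (auto simp: precedes_def)
  qed
qed

end

theory Submission
  imports Defs
begin

text \<open>Truncating a placement to its first \<open>n\<close> columns corresponds under \<open>\<Psi>\<close> to
  restricting the partition to \<open>[n]\<close>, so everything follows by induction on \<open>n\<close> from
  a single column. Let \<open>D\<close> be a placement on \<open>B\<^sub>n\<close> and let \<open>m\<close> be the number of rows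
  among \<open>1, \<dots>, n\<close> without a rook of \<open>D\<close>, which is also the number of blocks of \<open>\<Psi>(D)\<close>.
  Leaving column \<open>n + 1\<close> empty gives \<open>j = m + 1\<close>; a rook in the free row \<open>r\<close> gives
  \<open>j = 1 + t\<close>, where \<open>t\<close> is the number of free rows below \<open>r\<close>. So the choices in the new
  column correspond bijectively to the places where \<open>n + 1\<close> can be inserted, and \<open>j\<close> is
  the row index that enters the weight of the partition.\<close>

section \<open>Rook placements\<close>

text \<open>The number of rooks is left open because truncation by a column may or may not remove
  one.\<close>

definition rooks :: "nat \<Rightarrow> (nat \<times> nat) set set" where
  "rooks n = {C. C \<subseteq> staircase n \<and>
     (\<forall>x\<in>C. \<forall>y\<in>C. x \<noteq> y \<longrightarrow> fst x \<noteq> fst y \<and> snd x \<noteq> snd y)}"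

text \<open>Row \<open>n\<close> is included although \<open>staircase n\<close> has no square in
  it: these are the rows in which column \<open>Suc n\<close> can take a rook.\<close>

definition free_rows :: "nat \<Rightarrow> (nat \<times> nat) set \<Rightarrow> nat set" where
  "free_rows n D = {1..n} - fst ` D"

definition free_below :: "nat \<Rightarrow> (nat \<times> nat) set \<Rightarrow> nat \<Rightarrow> nat" where
  "free_below n D r = card {r' \<in> free_rows n D. r < r'}"

lemma rook_placements_eq: "rook_placements n k = {C \<in> rooks n. card C = k}"
  by (auto simp: rook_placements_def rooks_def)

lemma rooks_0: "rooks 0 = {{}}"
  by (auto simp: rooks_def staircase_def)

lemma finite_staircase: "finite (staircase n)"
  by (rule finite_subset[of _ "{1..n} \<times> {1..n}"]) (auto simp: staircase_def)

lemma finite_rooks: "D \<in> rooks n \<Longrightarrow> finite D"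
  unfolding rooks_def using finite_staircase finite_subset by blast

lemma rooks_square: "D \<in> rooks n \<Longrightarrow> (r, c) \<in> D \<Longrightarrow> 1 \<le> r \<and> r < c \<and> c \<le> n"
  by (auto simp: rooks_def staircase_def)

lemma card_rows: "D \<in> rooks n \<Longrightarrow> card (fst ` D) = card D"
  by (rule card_image) (auto simp: rooks_def inj_on_def)

lemma rows_subset: "D \<in> rooks n \<Longrightarrow> fst ` D \<subseteq> {1..n}"
  by (fastforce dest: rooks_square)

lemma card_free_rows:
  assumes "D \<in> rooks n"
  shows "card (free_rows n D) + card D = n"
proof -
  have "card (free_rows n D) = n - card D"
    unfolding free_rows_def
    by (subst card_Diff_subset)
      (use assms finite_rooks rows_subset card_rows in auto)
  moreover have "card D \<le> n"
    using card_mono[OF _ rows_subset[OF assms]] card_rows[OF assms] by simp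
  ultimately show ?thesis by simp
qed

lemma rooks_insert:
  assumes "D \<in> rooks n" and "r \<in> free_rows n D"
  shows "insert (r, Suc n) D \<in> rooks (Suc n)"
  unfolding rooks_def
proof (intro CollectI conjI ballI impI)
  show "insert (r, Suc n) D \<subseteq> staircase (Suc n)"
    using assms by (fastforce simp: free_rows_def staircase_def dest: rooks_square)
  fix x y
  assume "x \<in> insert (r, Suc n) D" "y \<in> insert (r, Suc n) D" "x \<noteq> y"
  moreover have "fst x \<noteq> fst y \<and> snd x \<noteq> snd y" if "x \<in> D" "y \<in> D" "x \<noteq> y"
    using that assms(1) by (auto simp: rooks_def)
  moreover have "fst z \<noteq> r \<and> snd z \<noteq> Suc n" if "z \<in> D" for z
    using that assms rooks_square[OF assms(1), of "fst z" "snd z"]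
    by (auto simp: free_rows_def)
  ultimately show "fst x \<noteq> fst y" and "snd x \<noteq> snd y"
    by (metis insert_iff fst_conv snd_conv)+
qed

lemma rooks_Suc_mono: "D \<in> rooks n \<Longrightarrow> D \<in> rooks (Suc n)"
  by (auto simp: rooks_def staircase_def)

text \<open>Distinct rooks have distinct columns, so the last column holds at most one; once it is
  removed, its row is free.\<close>

lemma rooks_Suc_cases:
  assumes "C \<in> rooks (Suc n)"
  obtains "C \<in> rooks n"
  | D r where "D \<in> rooks n" "r \<in> free_rows n D" "C = insert (r, Suc n) D"
proof (cases "\<exists>r. (r, Suc n) \<in> C")
  case False
  have "(r, c) \<in> staircase n" if "(r, c) \<in> C" for r c
  proof -
    have "c \<noteq> Suc n" using False that by blast
    then show ?thesis
      using rooks_square[OF assms that] by (simp add: staircase_def)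
  qed
  then have "C \<subseteq> staircase n" by auto
  then have "C \<in> rooks n" using assms by (simp add: rooks_def)
  then show ?thesis by (rule that(1))
next
  case True
  then obtain r where r: "(r, Suc n) \<in> C" by blast
  let ?D = "C - {(r, Suc n)}"
  have uniq: "fst x \<noteq> r \<and> snd x \<noteq> Suc n" if "x \<in> ?D" for x
    using assms r that unfolding rooks_def by fastforce
  have "?D \<subseteq> staircase n"
  proof
    fix x assume "x \<in> ?D"
    then show "x \<in> staircase n"
      using uniq[of x] rooks_square[OF assms, of "fst x" "snd x"]
      by (cases x) (auto simp: staircase_def)
  qed
  then have "?D \<in> rooks n"
    using assms by (auto simp: rooks_def)
  moreover have "r \<in> free_rows n ?D"
    using uniq rooks_square[OF assms r] by (fastforce simp: free_rows_def)
  ultimately show ?thesis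
    using r by (intro that(2)) auto
qed

text \<open>The count strictly decreases as the row grows, hence is injective, and it stays below
  the number of free rows because the row itself is not counted. Equal finite cardinalities give
  surjectivity.\<close>

lemma bij_betw_free_below:
  "bij_betw (free_below n D) (free_rows n D) {..<card (free_rows n D)}"
proof -
  let ?F = "free_rows n D"
  have fin: "finite ?F" by (simp add: free_rows_def)
  have less: "free_below n D r' < free_below n D r" if "r' \<in> ?F" "r < r'" for r r'
    unfolding free_below_def using that fin by (intro psubset_card_mono) auto
  have inj: "inj_on (free_below n D) ?F"
    by (rule linorder_inj_onI') (use less in fastforce)+
  moreover have "free_below n D ` ?F \<subseteq> {..<card ?F}"
    unfolding free_below_def using fin by (auto intro!: psubset_card_mono)
  ultimately show ?thesis
    unfolding bij_betw_def by (metis card_image card_lessThan card_subset_eq finite_lessThan)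
qed

section \<open>Column weights\<close>

text \<open>A column sees only its own rooks and those to its west, so neither later columns nor the
  board size matter.\<close>

lemma column_weight_cong:
  assumes "{x \<in> C. snd x \<le> i} = {x \<in> C'. snd x \<le> i}" and "i \<le> n" "i \<le> n'"
  shows "column_weight n C i = column_weight n' C' i"
proof -
  have mem: "(r, c) \<in> C \<longleftrightarrow> (r, c) \<in> C'" if "c \<le> i" for r c
    using assms(1) that by (auto simp: set_eq_iff)
  have "(r, i) \<in> ne_squares n C \<longleftrightarrow> (r, i) \<in> ne_squares n' C'" for r
    using assms(2,3) mem by (auto simp: ne_squares_def staircase_def)
  then show ?thesis
    by (simp add: column_weight_def ne_def mem)
qed

lemma degree_column_weight:
  "degree (column_weight n C i) = card {r. (r, i) \<in> C} + ne n C i"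
proof -
  have "degree (q - 1) = 1" "q \<noteq> 0" "q - 1 \<noteq> 0" "degree q = 1"
    by (auto simp: q_def one_pCons)
  then show ?thesis
    by (simp add: column_weight_def degree_mult_eq degree_power_eq)
qed

text \<open>Without a rook in the column, a square is north-east exactly when its row has a rook to
  the west, and distinct rooks occupy distinct rows.\<close>

lemma column_weight_empty:
  assumes "D \<in> rooks n"
  shows "column_weight (Suc n) D (Suc n) = q ^ card D"
    and "degree (column_weight (Suc n) D (Suc n)) = card D"
proof -
  have none: "{r. (r, Suc n) \<in> D} = {}"
    using rooks_square[OF assms] by fastforce
  have "{r. (r, Suc n) \<in> ne_squares (Suc n) D} = fst ` D"
    using rooks_square[OF assms] by (force simp: ne_squares_def staircase_def image_iff)
  then have ne: "ne (Suc n) D (Suc n) = card D"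
    using card_rows[OF assms] by (simp add: ne_def)
  show "column_weight (Suc n) D (Suc n) = q ^ card D"
    by (simp only: column_weight_def none ne) simp
  show "degree (column_weight (Suc n) D (Suc n)) = card D"
    by (simp only: degree_column_weight none ne) simp
qed

lemma column_weight_rook:
  assumes "D \<in> rooks n" and "r \<in> free_rows n D"
  shows "column_weight (Suc n) (insert (r, Suc n) D) (Suc n)
      = (q - 1) * q ^ (n - Suc (free_below n D r))"
    and "degree (column_weight (Suc n) (insert (r, Suc n) D) (Suc n)) = n - free_below n D r"
proof -
  let ?C = "insert (r, Suc n) D"
  have one: "{r'. (r', Suc n) \<in> ?C} = {r}"
    using rooks_square[OF assms(1)] by fastforce
  have fin: "finite (free_rows n D)" by (simp add: free_rows_def)
  have west: "(\<exists>c<Suc n. (r', c) \<in> ?C) \<longleftrightarrow> r' \<in> fst ` D" for r'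
  proof -
    have "c < Suc n" if "(r', c) \<in> D" for c
      using rooks_square[OF assms(1) that] by simp
    then have "(\<exists>c<Suc n. (r', c) \<in> ?C) \<longleftrightarrow> (\<exists>c. (r', c) \<in> D)" by auto
    then show ?thesis by force
  qed
  have column: "(r', Suc n) \<in> ?C \<longleftrightarrow> r' = r" for r'
    using one by blast
  \<comment> \<open>All squares above the rook are north-east; below it, only those in occupied rows
    are.\<close>
  have "{r'. (r', Suc n) \<in> ne_squares (Suc n) ?C}
      = {1..n} - insert r {r' \<in> free_rows n D. r < r'}"
    unfolding ne_squares_def mem_Collect_eq case_prod_conv west column
    using assms(2) by (auto simp: staircase_def free_rows_def)
  also have "card \<dots> = n - Suc (free_below n D r)"
    by (subst card_Diff_subset)
      (use assms(2) fin in \<open>auto simp: free_rows_def free_below_def\<close>)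
  finally have ne: "ne (Suc n) ?C (Suc n) = n - Suc (free_below n D r)"
    by (simp add: ne_def)
  have "free_below n D r < card (free_rows n D)"
    using bij_betw_free_below[of n D] assms(2) by (auto simp: bij_betw_def)
  \<comment> \<open>Strictness keeps \<open>n - Suc (free_below n D r)\<close> from truncating, so
    adding 1 for the rook gives the stated degree.\<close>
  then have lt: "free_below n D r < n"
    using card_free_rows[OF assms(1)] by linarith
  show "column_weight (Suc n) ?C (Suc n) = (q - 1) * q ^ (n - Suc (free_below n D r))"
    by (simp only: column_weight_def one ne) simp
  show "degree (column_weight (Suc n) ?C (Suc n)) = n - free_below n D r"
    by (simp only: degree_column_weight one ne) (use lt in simp)
qed

section \<open>Set partitions\<close>

lemma blocks:
  assumes "partition_on {1..n} S"
  shows "set (blocks S) = S" and "distinct (blocks S)" and "length (blocks S) = card S"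
proof -
  have *: "set (blocks S) = S \<and> sorted_wrt precedes (blocks S)"
    unfolding blocks_def by (rule theI'[OF blocks_unique[OF assms]])
  then show set: "set (blocks S) = S" by blast
  have "sorted_wrt (\<noteq>) (blocks S)"
    by (rule sorted_wrt_mono_rel[of _ precedes]) (use * in \<open>auto simp: precedes_def\<close>)
  then show dist: "distinct (blocks S)"
    by (simp add: distinct_conv_nth sorted_wrt_iff_nth_less) (metis linorder_neqE_nat)
  show "length (blocks S) = card S"
    using distinct_card[OF dist] set by simp
qed

lemma partition_finite: "partition_on {1..n::nat} S \<Longrightarrow> finite S"
  using finite_elements by blast

lemma partition_block:
  "partition_on {1..n::nat} S \<Longrightarrow> s \<in> S \<Longrightarrow> s \<subseteq> {1..n} \<and> s \<noteq> {} \<and> finite s"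
  unfolding partition_on_def using finite_subset[of s "{1..n}"] by blast

lemma partition_disjoint:
  "partition_on A S \<Longrightarrow> s \<in> S \<Longrightarrow> t \<in> S \<Longrightarrow> x \<in> s \<Longrightarrow> x \<in> t \<Longrightarrow> s = t"
  unfolding partition_on_def disjoint_def by blast

text \<open>Disjointness puts \<open>x\<close> in a single block and distinctness of the list fixes
  its index; \<open>Suc\<close> passes from 0-based to 1-based rows.\<close>

lemma row_of_nth:
  assumes "partition_on {1..n} S" and "t < card S" and "x \<in> blocks S ! t"
  shows "row_of S x = Suc t"
  unfolding row_of_def
proof (rule the_equality)
  show "1 \<le> Suc t \<and> Suc t \<le> card S \<and> x \<in> blocks S ! (Suc t - 1)"
    using assms by simp
  fix r assume r: "1 \<le> r \<and> r \<le> card S \<and> x \<in> blocks S ! (r - 1)"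
  note b = blocks[OF assms(1)]
  have r': "r - 1 < card S" using r by linarith
  have "blocks S ! i \<in> S" if "i < card S" for i
    using nth_mem[of i "blocks S"] b(1,3) that by simp
  from this[OF r'] this[OF assms(2)] have "blocks S ! (r - 1) = blocks S ! t"
    by (rule partition_disjoint[OF assms(1)]) (use r assms(3) in simp_all)
  then have "r - 1 = t"
    using nth_eq_iff_index_eq[OF b(2), of "r - 1" t] b(3) r' assms(2) by simp
  then show "r = Suc t" using r by linarith
qed

lemma block_of_eq:
  assumes "partition_on A S" and "s \<in> S" and "x \<in> s"
  shows "block_of S x = s"
  unfolding block_of_def
  by (rule the_equality) (use assms partition_disjoint[OF assms(1) _ assms(2) _ assms(3)] in blast)+

lemma restrict_restrict:
  assumes "i \<le> n"
  shows "restrict_partition (restrict_partition S n) i = restrict_partition S i"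
proof -
  have "{1..n} \<inter> {1..i} = {1..i}" using assms by auto
  then have "(s \<inter> {1..n}) \<inter> {1..i} = s \<inter> {1..i}" for s
    by (metis Int_assoc)
  then have "(\<lambda>s. s \<inter> {1..i}) ` (\<lambda>s. s \<inter> {1..n}) ` S = (\<lambda>s. s \<inter> {1..i}) ` S"
    by (simp add: image_image)
  \<comment> \<open>An empty block restricts to the empty block, which is discarded anyway, so
    removing it earlier changes nothing.\<close>
  moreover have "(\<lambda>s. s \<inter> {1..i}) ` (X - {{}}) - {{}} = (\<lambda>s. s \<inter> {1..i}) ` X - {{}}" for X
    by auto
  ultimately show ?thesis
    by (simp add: restrict_partition_def)
qed

lemma restrict_self:
  assumes "partition_on {1..n} S"
  shows "restrict_partition S n = S"
proof -
  have "s \<inter> {1..n} = s" if "s \<in> S" for s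
    using partition_block[OF assms that] by blast
  then have "(\<lambda>s. s \<inter> {1..n}) ` S = S"
    by simp
  then show ?thesis
    using partition_block[OF assms] by (auto simp: restrict_partition_def)
qed

lemma partition_restrict:
  assumes "partition_on {1..Suc n} S"
  shows "partition_on {1..n} (restrict_partition S n)"
proof -
  have "partition_on ({1..n} \<inter> {1..Suc n}) ((\<inter>) {1..n} ` S - {{}})"
    by (rule partition_on_restrict[OF assms])
  moreover have "{1..n} \<inter> {1..Suc n} = {1..n}" by auto
  ultimately show ?thesis
    by (simp add: restrict_partition_def Int_commute)
qed

section \<open>Adding the element \<open>Suc n\<close> to a set partition\<close>

lemma insert_at_new:
  "insert_at i (Suc (card S)) S = insert {i} S"
  by (simp add: insert_at_def)

lemma insert_at_old:
  "t < card S \<Longrightarrow> insert_at i (Suc t) S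
    = insert (insert i (blocks S ! t)) (S - {blocks S ! t})"
  by (simp add: insert_at_def Let_def)

lemma new_block:
  assumes S: "partition_on {1..n} S"
  defines "S' \<equiv> insert {Suc n} S"
  shows "partition_on {1..Suc n} S'" and "restrict_partition S' n = S"
    and "card S' = Suc (card S)" and "step_weight S' (Suc n) = q ^ (n - card S)"
proof -
  have notin: "Suc n \<notin> s" if "s \<in> S" for s
    using partition_block[OF S that] by auto
  have "{1..Suc n} - {Suc n} = {1..n}" by auto
  then show part: "partition_on {1..Suc n} S'"
    unfolding S'_def using notin S by (subst partition_on_insert) (auto simp: disjnt_def)
  have "restrict_partition S' n = restrict_partition S n"
    by (auto simp: S'_def restrict_partition_def)
  then show restr: "restrict_partition S' n = S"
    using restrict_self[OF S] by simp
  show "card S' = Suc (card S)"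
    unfolding S'_def using notin partition_finite[OF S] by (subst card_insert_disjoint) auto
  have "block_of S' (Suc n) = {Suc n}"
    by (rule block_of_eq[OF part]) (auto simp: S'_def)
  then show "step_weight S' (Suc n) = q ^ (n - card S)"
    by (simp add: step_weight_def restr restrict_self[OF part])
qed

text \<open>\<open>Suc n\<close> exceeds every element of \<open>s\<close>, so the least element of
  the block stays \<open>Min s\<close>, whose row in \<open>S\<close> is \<open>Suc t\<close>. The
  last conclusion lets injectivity recover the extended block.\<close>

lemma extended_block:
  assumes S: "partition_on {1..n} S" and t: "t < card S"
  defines "s \<equiv> blocks S ! t"
  defines "S' \<equiv> insert (insert (Suc n) s) (S - {s})"
  shows "partition_on {1..Suc n} S'" and "restrict_partition S' n = S"
    and "card S' = card S" and "step_weight S' (Suc n) = (q - 1) * q ^ (n - Suc t)"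
    and "block_of S' (Suc n) = insert (Suc n) s"
proof -
  have s: "s \<in> S"
    using blocks[OF S] t nth_mem[of t "blocks S"] by (simp add: s_def)
  note sb = partition_block[OF S s]
  have notin: "Suc n \<notin> u" if "u \<in> S" for u
    using partition_block[OF S that] by auto
  have un: "\<Union> S = {1..n}" using S by (simp add: partition_on_def)
  show part: "partition_on {1..Suc n} S'"
  proof (rule partition_onI)
    show "{} \<notin> S'"
      using partition_block[OF S] by (auto simp: S'_def)
    have "\<Union> S' = insert (Suc n) (\<Union> S)"
      using s by (auto simp: S'_def)
    then show "\<Union> S' = {1..Suc n}"
      by (simp add: un atLeastAtMostSuc_conv)
    show "disjnt p p'" if "p \<in> S'" "p' \<in> S'" "p \<noteq> p'" for p p'
      using that notin partition_disjoint[OF S] s unfolding S'_def disjnt_def by blast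
  qed
  have "u \<inter> {1..n} = u" if "u \<in> S" for u
    using partition_block[OF S that] by blast
  moreover from this have "insert (Suc n) s \<inter> {1..n} = s"
    using s by auto
  ultimately have "(\<lambda>s. s \<inter> {1..n}) ` S' = S"
    using s by (auto simp: S'_def image_iff)
  then show restr: "restrict_partition S' n = S"
    using partition_block[OF S] by (auto simp: restrict_partition_def)
  have "insert (Suc n) s \<notin> S" using notin by blast
  then show "card S' = card S"
    unfolding S'_def using s partition_finite[OF S]
    by (metis card_Suc_Diff1 card_insert_disjoint finite_Diff DiffD1)
  show blk: "block_of S' (Suc n) = insert (Suc n) s"
    by (rule block_of_eq[OF part]) (auto simp: S'_def)
  have Min_in: "Min s \<in> s" using sb by simp
  then have "Min s \<le> n" using sb by (meson atLeastAtMost_iff subsetD)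
  then have Min: "Min (insert (Suc n) s) = Min s" and "Suc n \<noteq> Min s"
    using sb by auto
  moreover have "row_of S (Min s) = Suc t"
    using row_of_nth[OF S t] Min_in by (simp add: s_def)
  ultimately show "step_weight S' (Suc n) = (q - 1) * q ^ (n - Suc t)"
    by (simp add: step_weight_def restr restrict_self[OF part] blk)
qed

text \<open>Converse of the two insertions: the cases are whether or not the block of
  \<open>Suc n\<close> is a singleton.\<close>

lemma partition_Suc_cases:
  assumes S': "partition_on {1..Suc n} S'"
  defines "S \<equiv> restrict_partition S' n"
  obtains "S' = insert {Suc n} S"
  | t where "t < card S" "S' = insert (insert (Suc n) (blocks S ! t)) (S - {blocks S ! t})"
proof -
  have S: "partition_on {1..n} S"
    unfolding S_def by (rule partition_restrict[OF S'])
  have "Suc n \<in> \<Union> S'" using S' by (auto simp: partition_on_def)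
  then obtain b where b: "b \<in> S'" "Suc n \<in> b" by blast
  have other: "u \<inter> {1..n} = u" if "u \<in> S'" "u \<noteq> b" for u
  proof -
    have "Suc n \<notin> u" using partition_disjoint[OF S'] that b by blast
    then show ?thesis
      using partition_block[OF S' that(1)] by (auto simp: le_Suc_eq)
  qed
  let ?s = "b \<inter> {1..n}"
  have bs: "b = insert (Suc n) ?s"
    using b partition_block[OF S' b(1)] by (auto simp: le_Suc_eq)
  have "(\<lambda>s. s \<inter> {1..n}) ` S' = insert ?s ((\<lambda>s. s \<inter> {1..n}) ` (S' - {b}))"
    using b(1) by blast
  also have "(\<lambda>s. s \<inter> {1..n}) ` (S' - {b}) = S' - {b}"
    using other by simp
  finally have Seq: "S = insert ?s (S' - {b}) - {{}}"
    by (simp add: S_def restrict_partition_def)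
  have ne: "{} \<notin> S'" using partition_block[OF S'] by blast
  show ?thesis
  proof (cases "?s = {}")
    case True
    then have "S' = insert {Suc n} S"
      using Seq bs b(1) ne by auto
    then show ?thesis by (rule that(1))
  next
    case False
    \<comment> \<open>A nonempty \<open>?s\<close> inside \<open>b\<close> is disjoint from every
      other block, so removing it from \<open>S\<close> leaves exactly the other blocks of
      \<open>S'\<close>.\<close>
    have "?s \<notin> S' - {b}"
      using partition_disjoint[OF S' _ b(1)] False by blast
    then have 1: "?s \<in> S" "S - {?s} = S' - {b}"
      using Seq ne False by auto
    obtain t where t: "t < card S" "blocks S ! t = ?s"
      using blocks[OF S] 1(1) by (metis in_set_conv_nth)
    have "S' = insert b (S - {?s})" using 1(2) b(1) by auto
    then show ?thesis using that(2) t bs by metis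
  qed
qed

text \<open>Step weights up to \<open>n\<close> look only at restrictions to at most
  \<open>n\<close>, so \<open>Suc n\<close> affects the last factor alone.\<close>

lemma partition_weight_Suc:
  "partition_weight (Suc n) S
    = partition_weight n (restrict_partition S n) * step_weight S (Suc n)"
proof -
  have "step_weight S i = step_weight (restrict_partition S n) i" if "i \<le> n" for i
    using that by (simp add: step_weight_def restrict_restrict)
  then show ?thesis
    by (simp add: partition_weight_def)
qed

section \<open>The map \<open>\<Psi>\<close>\<close>

lemma Psi_step_cong:
  assumes "{x \<in> C. snd x \<le> i} = {x \<in> C'. snd x \<le> i}" and "i \<le> n" "i \<le> n'"
  shows "Psi_step n C i = Psi_step n' C' i"
  using assms
proof (induction n C i rule: Psi_step.induct)
  case (3 n C i)
  have "{x \<in> A. snd x \<le> Suc i} = {x \<in> {x \<in> A. snd x \<le> Suc (Suc i)}. snd x \<le> Suc i}"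
    for A :: "(nat \<times> nat) set"
    by auto
  from this[of C] this[of C'] have "{x \<in> C. snd x \<le> Suc i} = {x \<in> C'. snd x \<le> Suc i}"
    by (simp only: "3.prems"(1))
  then show ?case
    using "3.IH" "3.prems" column_weight_cong[OF "3.prems"] by simp
qed auto

text \<open>At \<open>n = 0\<close> this absorbs the separate clause of \<open>Psi_step\<close> for \<open>1\<close>, so that
  the induction can start from the empty placement.\<close>

lemma Psi_Suc:
  assumes "D \<in> rooks n" and "{x \<in> C. snd x \<le> n} = D" and "C \<in> rooks (Suc n)"
  shows "Psi (Suc n) C
    = insert_at (Suc n) (Suc n - degree (column_weight (Suc n) C (Suc n))) (Psi n D)"
proof (cases n)
  case 0
  have "C \<subseteq> staircase (Suc 0)" using assms(3) 0 by (simp add: rooks_def)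
  then have "C = {}" by (auto simp: staircase_def)
  then have "degree (column_weight (Suc 0) C (Suc 0)) = 0"
    using column_weight_empty(2)[of "{}" 0] by (simp add: rooks_0)
  then show ?thesis using 0 by (simp add: Psi_def insert_at_def)
next
  case (Suc i)
  \<comment> \<open>The recursion for \<open>C\<close> runs on the larger board, so its stage
    \<open>n\<close> has to be identified with \<open>Psi n D\<close>.\<close>
  have "{x \<in> C. snd x \<le> n} = {x \<in> D. snd x \<le> n}" using assms(2) by auto
  then have "Psi_step (Suc n) C n = Psi_step n D n"
    by (rule Psi_step_cong) auto
  then show ?thesis by (simp add: Psi_def Suc)
qed

lemma rook_weight_Suc:
  assumes "D = {x \<in> C. snd x \<le> n}"
  shows "rook_weight (Suc n) C = rook_weight n D * column_weight (Suc n) C (Suc n)"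
proof -
  have "column_weight (Suc n) C i = column_weight n D i" if "i \<le> n" for i
    by (rule column_weight_cong) (use assms that in auto)
  then show ?thesis
    by (simp add: rook_weight_def)
qed

section \<open>The effect of the last column on \<open>Psi\<close>\<close>

lemma truncate_same: "D \<in> rooks n \<Longrightarrow> {x \<in> D. snd x \<le> n} = D"
  by (auto dest: rooks_square)

lemma truncate_insert: "D \<in> rooks n \<Longrightarrow> {x \<in> insert (r, Suc n) D. snd x \<le> n} = D"
  by (auto dest: rooks_square)

text \<open>The count is a hypothesis because it is established only by the induction in
  \<open>Psi_properties\<close>, which calls this lemma.\<close>

lemma Psi_empty_column:
  assumes "D \<in> rooks n" and "card (Psi n D) + card D = n"
  shows "Psi (Suc n) D = insert {Suc n} (Psi n D)"
proof -
  have "Suc n - degree (column_weight (Suc n) D (Suc n)) = Suc (card (Psi n D))"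
    using assms(2) by (simp add: column_weight_empty(2)[OF assms(1)])
  then show ?thesis
    using Psi_Suc[OF assms(1) truncate_same rooks_Suc_mono] assms(1)
    by (simp add: insert_at_new)
qed

text \<open>There are as many blocks as free rows, so \<open>t\<close> is the 0-based index of an
  existing block.\<close>

lemma Psi_rook_column:
  assumes "D \<in> rooks n" and "card (Psi n D) + card D = n" and "r \<in> free_rows n D"
  defines "t \<equiv> free_below n D r"
  shows "t < card (Psi n D)"
    and "Psi (Suc n) (insert (r, Suc n) D)
      = insert (insert (Suc n) (blocks (Psi n D) ! t)) (Psi n D - {blocks (Psi n D) ! t})"
proof -
  have "t < card (free_rows n D)"
    using bij_betw_free_below[of n D] assms(3) by (auto simp: bij_betw_def t_def)
  then show t: "t < card (Psi n D)"
    using card_free_rows[OF assms(1)] assms(2) by linarith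
  then have "Suc n - degree (column_weight (Suc n) (insert (r, Suc n) D) (Suc n)) = Suc t"
    using assms(2) column_weight_rook(2)[OF assms(1,3)] by (simp add: t_def)
  then show "Psi (Suc n) (insert (r, Suc n) D)
      = insert (insert (Suc n) (blocks (Psi n D) ! t)) (Psi n D - {blocks (Psi n D) ! t})"
    using Psi_Suc[OF assms(1) truncate_insert[OF assms(1)] rooks_insert[OF assms(1,3)]]
    by (simp add: insert_at_old[OF t])
qed

text \<open>The claims are proved together: the count decides which kind of insertion occurs, the
  partition property makes the ordered list of blocks meaningful, and the weights then match factor
  by factor.\<close>

lemma Psi_properties:
  assumes "C \<in> rooks n"
  shows "partition_on {1..n} (Psi n C) \<and> card (Psi n C) + card C = n
    \<and> rook_weight n C = partition_weight n (Psi n C)"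
  using assms
proof (induction n arbitrary: C)
  case 0
  then show ?case
    by (simp add: rooks_0 Psi_def partition_on_def rook_weight_def partition_weight_def)
next
  case (Suc n)
  from Suc.prems show ?case
  proof (cases rule: rooks_Suc_cases)
    case 1
    note IH = Suc.IH[OF 1]
    have part: "partition_on {1..n} (Psi n C)" and card: "card (Psi n C) + card C = n"
      using IH by auto
    have P: "Psi (Suc n) C = insert {Suc n} (Psi n C)"
      by (rule Psi_empty_column[OF 1 card])
    have "card C = n - card (Psi n C)" using card by simp
    then show ?thesis
      using IH card by (simp add: P new_block[OF part] partition_weight_Suc
        rook_weight_Suc[OF truncate_same[OF 1, symmetric]] column_weight_empty(1)[OF 1] del: One_nat_def)
  next
    case (2 D r)
    note IH = Suc.IH[OF 2(1)]
    have part: "partition_on {1..n} (Psi n D)" and card: "card (Psi n D) + card D = n"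
      using IH by auto
    note P = Psi_rook_column[OF 2(1) card 2(2)]
    have "(r, Suc n) \<notin> D" using rooks_square[OF 2(1)] by fastforce
    then have "card C = Suc (card D)"
      using finite_rooks[OF 2(1)] by (simp add: 2(3))
    then show ?thesis
      using IH card unfolding 2(3)
      by (simp add: P(2) extended_block[OF part P(1)] partition_weight_Suc
        rook_weight_Suc[OF truncate_insert[OF 2(1), symmetric]]
        column_weight_rook(1)[OF 2(1,2)] del: One_nat_def)
  qed
qed

lemma partition_Psi: "C \<in> rooks n \<Longrightarrow> partition_on {1..n} (Psi n C)"
  and card_Psi: "C \<in> rooks n \<Longrightarrow> card (Psi n C) + card C = n"
  by (simp_all only: Psi_properties)

text \<open>Restricting the partition undoes the last column, so by induction the truncated
  placements agree and only the last column remains to be recovered.\<close>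

lemma inj_on_Psi: "inj_on (Psi n) (rooks n)"
proof (induction n)
  case 0
  then show ?case by (simp add: rooks_0)
next
  case (Suc n)
  have truncate: "{x \<in> C. snd x \<le> n} \<in> rooks n
      \<and> restrict_partition (Psi (Suc n) C) n = Psi n {x \<in> C. snd x \<le> n}"
    if "C \<in> rooks (Suc n)" for C
    using that
  proof (cases rule: rooks_Suc_cases)
    case 1
    then show ?thesis
      by (simp add: truncate_same[OF 1] Psi_empty_column card_Psi new_block(2)[OF partition_Psi[OF 1]])
  next
    case (2 D r)
    note P = Psi_rook_column[OF 2(1) card_Psi[OF 2(1)] 2(2)]
    show ?thesis unfolding 2(3) truncate_insert[OF 2(1)]
      using 2(1) by (simp add: P(2) extended_block(2)[OF partition_Psi[OF 2(1)] P(1)])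
  qed
  show ?case
  proof (rule inj_onI)
    fix C C' assume C: "C \<in> rooks (Suc n)" and C': "C' \<in> rooks (Suc n)"
      and eq: "Psi (Suc n) C = Psi (Suc n) C'"
    have same: "{x \<in> C. snd x \<le> n} = {x \<in> C'. snd x \<le> n}"
      using inj_onD[OF Suc] truncate[OF C] truncate[OF C'] eq by auto
    \<comment> \<open>Equal block counts mean equal rook counts, which settles the cases where one
      placement leaves the last column empty.\<close>
    have card: "card C = card C'"
      using card_Psi[OF C] card_Psi[OF C'] eq by simp
    show "C = C'"
      using C
    proof (cases rule: rooks_Suc_cases)
      case 1
      then have "C \<subseteq> C'" using same truncate_same by blast
      then show ?thesis using card finite_rooks[OF C'] by (simp add: card_subset_eq)
    next
      case (2 D r)
      note D = 2
      from C' show ?thesis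
      proof (cases rule: rooks_Suc_cases)
        case 1
        then have "C' \<subseteq> C" using same truncate_same by blast
        then show ?thesis using card finite_rooks[OF C] by (metis card_subset_eq)
      next
        case (2 D' r')
        have DD: "D' = D"
          using same truncate_insert[OF D(1)] truncate_insert[OF 2(1)] D(3) 2(3) by metis
        let ?S = "Psi n D" and ?t = "free_below n D r" and ?t' = "free_below n D r'"
        note S = partition_Psi[OF D(1)]
        note P = Psi_rook_column[OF D(1) card_Psi[OF D(1)] D(2)]
        note P' = Psi_rook_column[OF D(1) card_Psi[OF D(1)] 2(2)[unfolded DD]]
        have "insert (Suc n) (blocks ?S ! ?t) = insert (Suc n) (blocks ?S ! ?t')"
          using extended_block(5)[OF S P(1)] extended_block(5)[OF S P'(1)] eq
          unfolding D(3) 2(3) DD P(2) P'(2) by simp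
        moreover have "Suc n \<notin> blocks ?S ! t" if "t < card ?S" for t
        proof -
          have "blocks ?S ! t \<in> ?S"
            using blocks[OF S] that nth_mem[of t "blocks ?S"] by simp
          then show ?thesis using partition_block[OF S] by fastforce
        qed
        \<comment> \<open>Once \<open>Suc n\<close> is cancelled, distinctness of the list gives
          equal indices, and injectivity of \<open>free_below\<close> gives equal rows.\<close>
        ultimately have "blocks ?S ! ?t = blocks ?S ! ?t'"
          using P(1) P'(1) by (metis insert_ident)
        then have "?t = ?t'"
          using blocks[OF S] P(1) P'(1) by (simp add: nth_eq_iff_index_eq)
        then have "r = r'"
          using bij_betw_imp_inj_on[OF bij_betw_free_below[of n D]] D(2) 2(2) DD
          by (auto dest: inj_onD)
        then show ?thesis using D(3) 2(3) DD by simp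
      qed
    qed
  qed
qed

text \<open>Restriction supplies \<open>D\<close> by induction; the way \<open>Suc n\<close> sits in
  \<open>S\<close> then dictates the last column.\<close>

lemma Psi_surj: "partition_on {1..n} S \<Longrightarrow> \<exists>C\<in>rooks n. Psi n C = S"
proof (induction n arbitrary: S)
  case 0
  then show ?case by (auto simp: rooks_0 Psi_def partition_on_def)
next
  case (Suc n)
  obtain D where D: "D \<in> rooks n" "Psi n D = restrict_partition S n"
    using Suc.IH[OF partition_restrict[OF Suc.prems]] by blast
  from Suc.prems show ?case
  proof (cases rule: partition_Suc_cases)
    case 1
    then show ?thesis
      using Psi_empty_column[OF D(1) card_Psi[OF D(1)]] rooks_Suc_mono[OF D(1)] D(2) by metis
  next
    case (2 t)
    have "card (Psi n D) = card (free_rows n D)"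
      using card_Psi[OF D(1)] card_free_rows[OF D(1)] by linarith
    then have "t \<in> {..<card (free_rows n D)}" using 2(1) D(2) by simp
    then obtain r where r: "r \<in> free_rows n D" "free_below n D r = t"
      using bij_betw_imp_surj_on[OF bij_betw_free_below[of n D]] by (metis imageE)
    have "Psi (Suc n) (insert (r, Suc n) D) = S"
      using Psi_rook_column(2)[OF D(1) card_Psi[OF D(1)] r(1)] 2(2) r(2) D(2) by simp
    then show ?thesis using rooks_insert[OF D(1) r(1)] by blast
  qed
qed

theorem theorem4p3:
  fixes n k :: nat
  assumes "n \<ge> 1" and "k \<le> n - 1"
  shows "bij_betw (Psi n) (rook_placements n k) (set_partitions n (n - k)) \<and>
         (\<forall>C\<in>rook_placements n k. rook_weight n C = partition_weight n (Psi n C))"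
proof
  \<comment> \<open>Both \<open>card C\<close> and \<open>k\<close> are at most \<open>n\<close>, so
    subtraction from \<open>n\<close> does not truncate, and fixing the number of rooks amounts to
    fixing the number of blocks.\<close>
  have "card C = k \<longleftrightarrow> card (Psi n C) = n - k" if "C \<in> rooks n" for C
    using card_Psi[OF that] assms by linarith
  then have "Psi n ` rook_placements n k = set_partitions n (n - k)"
    unfolding rook_placements_eq set_partitions_def
    using partition_Psi Psi_surj by (auto simp: image_iff) metis
  moreover have "inj_on (Psi n) (rook_placements n k)"
    by (rule inj_on_subset[OF inj_on_Psi]) (auto simp: rook_placements_eq)
  ultimately show "bij_betw (Psi n) (rook_placements n k) (set_partitions n (n - k))"
    by (simp add: bij_betw_def)
  show "\<forall>C\<in>rook_placements n k. rook_weight n C = partition_weight n (Psi n C)"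
    using Psi_properties by (auto simp: rook_placements_eq)
qed

end
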